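(* Let $n,m\geq 1$, let $U\subseteq\mathbb R^n$ be open and let $f\colon U\to\mathbb R^m$ be differentiable at every point of $U$ (not necessarily continuously differentiable). Then there exists a slope function $\Phi\colon U\times U\to\mathcal L(\mathbb R^n,\mathbb R^m)$ for $f$ that is separately continuous at every point of the diagonal, that is, for every $x\in U$ both maps $y\mapsto\Phi(x,y)$ and $y\mapsto\Phi(y,x)$ are continuous at $y=x$. Moreover, such a slope function can be chosen to be also symmetric, that is, $\Phi(x,y)=\Phi(y,x)$ for all $x,y\in U$.
   Context: $\mathcal L(\mathbb R^n,\mathbb R^m)$ denotes the space of linear maps from $\mathbb R^n$ to $\mathbb R^m$ with the operator norm. Differentiability: $f\colon U\to\mathbb R^m$ is differentiable at $x\in U$ if there exists a map $\Phi_x\colon U\to\mathcal L(\mathbb R^n,\mathbb R^m)$, continuous at $x$, such that $f(y)=f(x)+\Phi_x(y)(y-x)$ for all $y\in U$. Such a $\Phi_x$ is called a slope function of $f$ at $x$, and $Df(x):=\Phi_x(x)$ is the derivative of $f$ at $x$ (this is equivalent to Fréchet differentiability, with the same derivative). If $f$ is differentiable at every point of $U$, a slope function for $f$ is a map $\Phi\colon U\times U\to\mathcal L(\mathbb R^n,\mathbb R^m)$ such that for every $x\in U$ the map $y\mapsto\Phi(x,y)$ is a slope function of $f$ at $x$. *)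

theory Defs
  imports "HOL-Analysis.Analysis"
begin

text \<open>
  A map with domain \<open>U\<close> is a total function of which only the values on \<open>U\<close> matter; continuity
  at a point of \<open>U\<close> is therefore taken relative to \<open>U\<close>. The type \<open>'a \<Rightarrow>\<^sub>L 'b\<close> carries the operator norm.
\<close>

definition slope_function_at ::
  "'a::euclidean_space set \<Rightarrow> ('a \<Rightarrow> 'b::euclidean_space) \<Rightarrow> 'a \<Rightarrow> ('a \<Rightarrow> 'a \<Rightarrow>\<^sub>L 'b) \<Rightarrow> bool" where
  "slope_function_at U f x \<Phi> \<longleftrightarrow>
     continuous (at x within U) \<Phi> \<and> (\<forall>y\<in>U. f y = f x + blinfun_apply (\<Phi> y) (y - x))"

definition slope_differentiable_at ::
  "'a::euclidean_space set \<Rightarrow> ('a \<Rightarrow> 'b::euclidean_space) \<Rightarrow> 'a \<Rightarrow> bool" where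
  "slope_differentiable_at U f x \<longleftrightarrow> (\<exists>\<Phi>. slope_function_at U f x \<Phi>)"

definition slope_function ::
  "'a::euclidean_space set \<Rightarrow> ('a \<Rightarrow> 'b::euclidean_space) \<Rightarrow> ('a \<Rightarrow> 'a \<Rightarrow> 'a \<Rightarrow>\<^sub>L 'b) \<Rightarrow> bool" where
  "slope_function U f \<Phi> \<longleftrightarrow> (\<forall>x\<in>U. slope_function_at U f x (\<Phi> x))"

definition separately_continuous_on_diagonal ::
  "'a::t2_space set \<Rightarrow> ('a \<Rightarrow> 'a \<Rightarrow> 'c::topological_space) \<Rightarrow> bool" where
  "separately_continuous_on_diagonal U \<Phi> \<longleftrightarrow>
     (\<forall>x\<in>U. continuous (at x within U) (\<lambda>y. \<Phi> x y) \<and> continuous (at x within U) (\<lambda>y. \<Phi> y x))"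

definition symmetric_on :: "'a set \<Rightarrow> ('a \<Rightarrow> 'a \<Rightarrow> 'c) \<Rightarrow> bool" where
  "symmetric_on U \<Phi> \<longleftrightarrow> (\<forall>x\<in>U. \<forall>y\<in>U. \<Phi> x y = \<Phi> y x)"

text \<open>Agreement with the Frechet derivative of the library.\<close>

lemma slope_function_at_imp_has_derivative:
  assumes "slope_function_at U f x \<Phi>"
  shows "(f has_derivative blinfun_apply (\<Phi> x)) (at x within U)"
  unfolding has_derivative_within_alt
proof (intro conjI allI impI)
  show "bounded_linear (blinfun_apply (\<Phi> x))" by (rule blinfun.bounded_linear_right)
  fix e :: real assume "e > 0"
  then obtain d where d: "d > 0" "\<And>y. y \<in> U \<Longrightarrow> dist y x < d \<Longrightarrow> dist (\<Phi> y) (\<Phi> x) < e"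
    using assms unfolding slope_function_at_def continuous_within_eps_delta by blast
  have "norm (f y - f x - \<Phi> x (y - x)) \<le> e * norm (y - x)" if y: "y \<in> U" "norm (y - x) < d" for y :: 'a
  proof -
    have "f y - f x - \<Phi> x (y - x) = (\<Phi> y - \<Phi> x) (y - x)"
      using assms y(1) by (simp add: slope_function_at_def blinfun.diff_left)
    also have "norm \<dots> \<le> norm (\<Phi> y - \<Phi> x) * norm (y - x)" by (rule norm_blinfun)
    also have "\<dots> \<le> e * norm (y - x)"
      using d(2)[OF y(1)] y(2) by (intro mult_right_mono) (auto simp: dist_norm)
    finally show ?thesis .
  qed
  with d(1) show "\<exists>d>0. \<forall>y\<in>U. norm (y - x) < d \<longrightarrow> norm (f y - f x - \<Phi> x (y - x)) \<le> e * norm (y - x)"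
    by blast
qed

lemma has_derivative_imp_slope_function_at:
  fixes f :: "'a::euclidean_space \<Rightarrow> 'b::euclidean_space"
  assumes "(f has_derivative f') (at x within U)"
  shows "\<exists>\<Phi>. slope_function_at U f x \<Phi> \<and> blinfun_apply (\<Phi> x) = f'"
proof -
  have bl: "bounded_linear f'" using assms by (rule has_derivative_bounded_linear)
  define r where "r y = f y - f x - f' (y - x)" for y :: 'a
  define L where "L y = (\<lambda>v. ((y - x) \<bullet> v / (norm (y - x))\<^sup>2) *\<^sub>R r y)" for y :: 'a
  have blL: "bounded_linear (L y)" for y :: 'a
    unfolding L_def by (intro linear_conv_bounded_linear[THEN iffD1] linearI)
      (simp_all add: inner_add_right add_divide_distrib scaleR_add_left)
  define \<Phi> where "\<Phi> y = Blinfun f' + Blinfun (L y)" for y :: 'a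
  have app: "blinfun_apply (\<Phi> y) v = f' v + L y v" for y v
    by (simp add: \<Phi>_def blinfun.add_left bounded_linear_Blinfun_apply bl blL)
  have Lx: "L x v = 0" for v by (simp add: L_def)
  have bound: "norm (\<Phi> y - \<Phi> x) \<le> e" if "norm (r y) \<le> e * norm (y - x)" "e > 0" for y e
  proof (rule norm_blinfun_bound)
    show "norm ((\<Phi> y - \<Phi> x) v) \<le> e * norm v" for v
    proof (cases "y = x")
      case True
      then show ?thesis using that by simp
    next
      case False
      have "norm ((\<Phi> y - \<Phi> x) v) = \<bar>(y - x) \<bullet> v\<bar> / (norm (y - x))\<^sup>2 * norm (r y)"
        by (simp add: blinfun.diff_left app Lx) (simp add: L_def)
      also have "\<dots> \<le> norm (y - x) * norm v / (norm (y - x))\<^sup>2 * (e * norm (y - x))"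
        using that by (intro mult_mono divide_right_mono Cauchy_Schwarz_ineq2) auto
      also have "\<dots> = e * norm v" using False by (simp add: power2_eq_square)
      finally show ?thesis .
    qed
  qed (use that in auto)
  have "continuous (at x within U) \<Phi>"
    unfolding continuous_within_eps_delta
  proof (intro allI impI)
    fix e :: real assume "e > 0"
    then have "e / 2 > 0" by simp
    then obtain d where "d > 0" "\<forall>y\<in>U. norm (y - x) < d \<longrightarrow> norm (r y) \<le> e / 2 * norm (y - x)"
      using assms unfolding has_derivative_within_alt r_def by blast
    then show "\<exists>d>0. \<forall>y\<in>U. dist y x < d \<longrightarrow> dist (\<Phi> y) (\<Phi> x) < e"
      using bound[of _ "e / 2"] \<open>e > 0\<close> by (intro exI[of _ d]) (force simp: dist_norm)
  qed
  moreover have "f y = f x + blinfun_apply (\<Phi> y) (y - x)" for y :: 'a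
    by (cases "y = x") (simp_all add: app L_def power2_norm_eq_inner r_def
        linear_0[OF bounded_linear.linear[OF bl]])
  moreover have "blinfun_apply (\<Phi> x) = f'" by (auto simp: app Lx)
  ultimately show ?thesis unfolding slope_function_at_def by blast
qed

lemma slope_differentiable_at_iff_differentiable:
  "slope_differentiable_at U f x \<longleftrightarrow> f differentiable (at x within U)"
  unfolding slope_differentiable_at_def differentiable_def
  using slope_function_at_imp_has_derivative has_derivative_imp_slope_function_at by blast

end

theory Submission
  imports Defs
begin

text \<open>
  Everything reduces to a symmetric operator-valued map \<open>A\<close> with \<open>A x y \<rightarrow> Df(x)\<close> as \<open>y \<rightarrow> x\<close> for
  every fixed \<open>x\<close>: for a symmetric map the two separate continuity conditions coincide, and the
  secant equation \<open>f y - f x = A x y (y - x)\<close> can be enforced afterwards by adding an operator of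
  rank one in the direction \<open>y - x\<close>. This correction is symmetric in \<open>x\<close> and \<open>y\<close> and is dominated by
  \<open>\<parallel>S y - A x y\<parallel>\<close> for any slope function \<open>S\<close> of \<open>f\<close> at \<open>x\<close>, hence it vanishes in the limit.

  The average of \<open>Df(x)\<close> and \<open>Df(y)\<close> does not serve as \<open>A x y\<close>, because \<open>Df\<close> may be discontinuous.
  But \<open>Df\<close> is of the first Baire class: it is the pointwise limit of the matrices \<open>g k\<close> of difference
  quotients with step \<open>1/k\<close>, which are continuous at each point of \<open>U\<close> once \<open>k\<close> is large. Averaging
  \<open>g k x\<close> and \<open>g k y\<close> for an index \<open>k\<close> that depends symmetrically on \<open>(x, y)\<close>, and that grows slowly
  enough for \<open>g k\<close> to vary little between \<open>x\<close> and \<open>y\<close>, yields \<open>A\<close>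
  (lemma \<open>symmetric_extension_from_diagonal\<close>).
\<close>

section \<open>Symmetric extension of a Baire-one function off the diagonal\<close>

text \<open>
  The largest index \<open>k\<close> such that \<open>x\<close> and \<open>y\<close> as well as \<open>g k x\<close> and \<open>g k y\<close> are at distance at most
  \<open>1/k\<close>. The conditions are multiplied out so that \<open>k = 0\<close> always qualifies; the first one bounds the
  admissible indices when \<open>x \<noteq> y\<close>.
\<close>

definition close_index :: "(nat \<Rightarrow> 'a::metric_space \<Rightarrow> 'b::metric_space) \<Rightarrow> 'a \<Rightarrow> 'a \<Rightarrow> nat" where
  "close_index g x y = Max {k. real k * dist x y \<le> 1 \<and> real k * dist (g k x) (g k y) \<le> 1}"

lemma close_index_commute: "close_index g x y = close_index g y x"
  by (simp add: close_index_def dist_commute)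

lemma finite_close_indices:
  fixes x y :: "'a::metric_space"
  assumes "x \<noteq> y"
  shows "finite {k. real k * dist x y \<le> 1 \<and> P k}"
proof (rule finite_subset)
  show "{k. real k * dist x y \<le> 1 \<and> P k} \<subseteq> {..nat \<lceil>1 / dist x y\<rceil>}"
  proof
    fix k assume "k \<in> {k. real k * dist x y \<le> 1 \<and> P k}"
    then have "real k \<le> 1 / dist x y" using assms by (simp add: field_simps)
    then show "k \<in> {..nat \<lceil>1 / dist x y\<rceil>}" by (simp add: le_nat_iff) linarith
  qed
qed simp

lemma close_index_close:
  assumes "x \<noteq> y"
  shows "real (close_index g x y) * dist (g (close_index g x y) x) (g (close_index g x y) y) \<le> 1"
proof -
  let ?K = "{k. real k * dist x y \<le> 1 \<and> real k * dist (g k x) (g k y) \<le> 1}"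
  have "0 \<in> ?K" by simp
  then have "?K \<noteq> {}" by blast
  then have "Max ?K \<in> ?K" by (intro Max_in finite_close_indices assms)
  then show ?thesis by (simp add: close_index_def)
qed

text \<open>
  For a fixed \<open>k\<close> at which \<open>g k\<close> is continuous in \<open>x\<close>, both closeness conditions hold for all \<open>y\<close> near
  \<open>x\<close>; hence the largest admissible index is eventually at least every such \<open>k\<close>.
\<close>

lemma filterlim_close_index:
  assumes "\<forall>\<^sub>F k in sequentially. isCont (g k) x"
  shows "filterlim (close_index g x) sequentially (at x)"
  unfolding filterlim_at_top
proof
  fix Z
  obtain k where k: "k \<ge> Z" "isCont (g k) x"
    using assms unfolding eventually_sequentially by (meson nat_le_linear)
  have "((\<lambda>y. real k * dist x y) \<longlongrightarrow> real k * dist x x) (at x)"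
    by (intro tendsto_intros)
  then have "\<forall>\<^sub>F y in at x. real k * dist x y < 1"
    by (rule order_tendstoD) simp
  moreover have "((\<lambda>y. real k * dist (g k x) (g k y)) \<longlongrightarrow> real k * dist (g k x) (g k x)) (at x)"
    using k(2) unfolding isCont_def by (intro tendsto_intros)
  then have "\<forall>\<^sub>F y in at x. real k * dist (g k x) (g k y) < 1"
    by (rule order_tendstoD) simp
  moreover have "\<forall>\<^sub>F y in at x. y \<noteq> x"
    by (simp add: eventually_at_filter)
  ultimately show "\<forall>\<^sub>F y in at x. Z \<le> close_index g x y"
  proof eventually_elim
    case (elim y)
    then have "k \<le> close_index g x y"
      unfolding close_index_def by (intro Max_ge finite_close_indices) auto
    with k(1) show ?case by simp
  qed
qed

text \<open>
  With \<open>k = close_index g x y\<close>, the midpoint of \<open>g k x\<close> and \<open>g k y\<close> is within \<open>1/k\<close> of \<open>g k x\<close>, and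
  \<open>k\<close> tends to infinity as \<open>y\<close> tends to \<open>x\<close>.
\<close>

lemma symmetric_extension_from_diagonal:
  fixes g :: "nat \<Rightarrow> 'a::metric_space \<Rightarrow> 'b::real_normed_vector"
  assumes cont: "\<And>x. x \<in> U \<Longrightarrow> \<forall>\<^sub>F k in sequentially. isCont (g k) x"
    and lim: "\<And>x. x \<in> U \<Longrightarrow> (\<lambda>k. g k x) \<longlonglongrightarrow> h x"
  obtains A where "\<And>x y. A x y = A y x" "\<And>x. A x x = h x" "\<And>x. x \<in> U \<Longrightarrow> isCont (A x) x"
proof -
  define N where "N = close_index g"
  define A where "A x y = (if x = y then h x else midpoint (g (N x y) x) (g (N x y) y))" for x y
  show thesis
  proof (rule that[of A])
    show "A x y = A y x" for x y
      by (simp add: A_def N_def close_index_commute[of g x y] midpoint_sym)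
    show diag: "A x x = h x" for x by (simp add: A_def)
    fix x assume x: "x \<in> U"
    have N: "filterlim (N x) sequentially (at x)"
      unfolding N_def by (rule filterlim_close_index[OF cont[OF x]])
    have "((\<lambda>y. g (N x y) x) \<longlongrightarrow> h x) (at x)"
      by (rule filterlim_compose[OF lim[OF x] N])
    moreover have "((\<lambda>y. A x y - g (N x y) x) \<longlongrightarrow> 0) (at x)"
    proof (rule Lim_null_comparison)
      show "((\<lambda>y. inverse (real (N x y))) \<longlongrightarrow> 0) (at x)"
        by (rule filterlim_compose[OF lim_inverse_n N])
      have "\<forall>\<^sub>F y in at x. N x y \<ge> 1"
        using N by (simp add: filterlim_at_top)
      moreover have "\<forall>\<^sub>F y in at x. y \<noteq> x"
        by (simp add: eventually_at_filter)
      ultimately show "\<forall>\<^sub>F y in at x. norm (A x y - g (N x y) x) \<le> inverse (real (N x y))"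
      proof eventually_elim
        case (elim y)
        have "norm (A x y - g (N x y) x) = dist (g (N x y) x) (g (N x y) y) / 2"
          using elim(2) by (simp add: A_def dist_norm[symmetric] dist_midpoint)
        also have "\<dots> \<le> dist (g (N x y) x) (g (N x y) y)" by simp
        also have "\<dots> \<le> inverse (real (N x y))"
          using close_index_close[of x y g] elim by (simp add: N_def field_simps)
        finally show ?case .
      qed
    qed
    ultimately have "((\<lambda>y. g (N x y) x + (A x y - g (N x y) x)) \<longlongrightarrow> h x + 0) (at x)"
      by (rule tendsto_add)
    then show "isCont (A x) x" by (simp add: isCont_def diag)
  qed
qed

section \<open>The derivative as a limit of difference quotients\<close>

definition outer_product ::
  "'a::real_inner \<Rightarrow> 'b::real_normed_vector \<Rightarrow> 'a \<Rightarrow>\<^sub>L 'b" where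
  "outer_product b w = blinfun_scaleR_left w o\<^sub>L blinfun_inner_left b"

lemma outer_product_apply [simp]: "outer_product b w v = (v \<bullet> b) *\<^sub>R w"
  by (simp add: outer_product_def)

lemma tendsto_outer_product:
  "(f \<longlongrightarrow> w) F \<Longrightarrow> ((\<lambda>x. outer_product b (f x)) \<longlongrightarrow> outer_product b w) F"
  unfolding outer_product_def
  by (intro bounded_bilinear.tendsto[OF bounded_bilinear_blinfun_compose]
      bounded_linear.tendsto[OF bounded_linear_blinfun_scaleR_left] tendsto_const)

definition difference_matrix ::
  "('a::euclidean_space \<Rightarrow> 'b::euclidean_space) \<Rightarrow> nat \<Rightarrow> 'a \<Rightarrow> 'a \<Rightarrow>\<^sub>L 'b" where
  "difference_matrix f k x =
     (\<Sum>b\<in>Basis. outer_product b (real k *\<^sub>R (f (x + b /\<^sub>R real k) - f x)))"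

lemma blinfun_eq_sum_Basis:
  fixes L :: "'a::euclidean_space \<Rightarrow>\<^sub>L 'b::euclidean_space"
  shows "L = (\<Sum>b\<in>Basis. outer_product b (L b))"
proof (rule blinfun_eqI)
  fix v
  have "L v = L (\<Sum>b\<in>Basis. (v \<bullet> b) *\<^sub>R b)" by (simp add: euclidean_representation)
  also have "\<dots> = (\<Sum>b\<in>Basis. (v \<bullet> b) *\<^sub>R L b)" by (simp add: blinfun.sum_right blinfun.scaleR_right)
  finally show "L v = (\<Sum>b\<in>Basis. outer_product b (L b)) v"
    by (simp add: blinfun.sum_left inner_commute)
qed

lemma tendsto_shift_inverse_nat:
  fixes x b :: "'a::real_normed_vector"
  shows "(\<lambda>k. x + b /\<^sub>R real k) \<longlonglongrightarrow> x"
proof -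
  have "(\<lambda>k. x + b /\<^sub>R real k) \<longlonglongrightarrow> x + 0 *\<^sub>R b"
    by (intro tendsto_intros lim_inverse_n)
  then show ?thesis by simp
qed

lemma difference_matrix_tendsto:
  assumes "open U" "x \<in> U" and S: "slope_function_at U f x S"
  shows "(\<lambda>k. difference_matrix f k x) \<longlonglongrightarrow> S x"
proof -
  have "isCont S x"
    using S at_within_open[OF assms(2,1)] by (simp add: slope_function_at_def)
  have "(\<lambda>k. real k *\<^sub>R (f (x + b /\<^sub>R real k) - f x)) \<longlonglongrightarrow> S x b" for b
  proof (rule Lim_transform_eventually)
    show "(\<lambda>k. S (x + b /\<^sub>R real k) b) \<longlonglongrightarrow> S x b"
      using isCont_tendsto_compose[OF \<open>isCont S x\<close> tendsto_shift_inverse_nat]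
      by (intro tendsto_intros)
    have "\<forall>\<^sub>F k in sequentially. x + b /\<^sub>R real k \<in> U"
      using tendsto_shift_inverse_nat assms(1,2) by (rule topological_tendstoD)
    then show "\<forall>\<^sub>F k in sequentially. S (x + b /\<^sub>R real k) b = real k *\<^sub>R (f (x + b /\<^sub>R real k) - f x)"
      using eventually_gt_at_top[of 0]
    proof eventually_elim
      case (elim k)
      then have "f (x + b /\<^sub>R real k) - f x = S (x + b /\<^sub>R real k) (b /\<^sub>R real k)"
        using S by (simp add: slope_function_at_def)
      then show ?case using elim(2) by (simp add: blinfun.scaleR_right)
    qed
  qed
  then have "(\<lambda>k. difference_matrix f k x) \<longlonglongrightarrow>
      (\<Sum>b\<in>Basis. outer_product b (S x b))"
    unfolding difference_matrix_def
    by (intro tendsto_sum tendsto_outer_product)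
  then show ?thesis by (simp only: blinfun_eq_sum_Basis[of "S x", symmetric])
qed

text \<open>
  Only large \<open>k\<close> are covered, since \<open>x + b / k\<close> may lie outside \<open>U\<close>, where nothing is known about \<open>f\<close>.
\<close>

lemma difference_matrix_eventually_isCont:
  assumes U: "open U" and x: "x \<in> U" and f: "continuous_on U f"
  shows "\<forall>\<^sub>F k in sequentially. isCont (difference_matrix f k) x"
proof -
  have f': "isCont f y" if "y \<in> U" for y
    using f U that by (simp add: continuous_on_eq_continuous_at)
  have "\<forall>\<^sub>F k in sequentially. x + b /\<^sub>R real k \<in> U" for b
    using tendsto_shift_inverse_nat U x by (rule topological_tendstoD)
  then have "\<forall>\<^sub>F k in sequentially. \<forall>b\<in>Basis. x + b /\<^sub>R real k \<in> U"
    by (simp add: eventually_ball_finite)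
  then show ?thesis
  proof eventually_elim
    case (elim k)
    have "isCont (\<lambda>y. f (y + b /\<^sub>R real k)) x" if "b \<in> Basis" for b
    proof (rule isCont_o2[where g = f])
      show "isCont (\<lambda>y. y + b /\<^sub>R real k) x" by (intro continuous_intros)
      show "isCont f (x + b /\<^sub>R real k)" using elim that by (intro f') blast
    qed
    then show ?case
      unfolding difference_matrix_def isCont_def
      using f'[OF x] unfolding isCont_def
      by (intro tendsto_sum tendsto_outer_product tendsto_scaleR tendsto_diff tendsto_const)
  qed
qed

section \<open>Enforcing the secant equation\<close>

text \<open>
  The operator of least norm that sends \<open>d\<close> to \<open>w\<close>, when \<open>d \<noteq> 0\<close>. For \<open>d = 0\<close> it is zero, by division
  by zero.
\<close>

definition rank_one :: "'a::euclidean_space \<Rightarrow> 'b::euclidean_space \<Rightarrow> 'a \<Rightarrow>\<^sub>L 'b" where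
  "rank_one d w = outer_product (d /\<^sub>R (norm d)\<^sup>2) w"

lemma rank_one_apply: "rank_one d w v = ((d \<bullet> v) / (norm d)\<^sup>2) *\<^sub>R w"
  by (simp add: rank_one_def inner_commute divide_inverse mult.commute)

lemma rank_one_apply_self: "d \<noteq> 0 \<Longrightarrow> rank_one d w d = w"
  by (simp add: rank_one_apply power2_norm_eq_inner)

lemma rank_one_0 [simp]: "rank_one 0 w = 0"
  by (rule blinfun_eqI) (simp add: rank_one_apply)

lemma rank_one_minus: "rank_one (- d) (- w) = rank_one d w"
  by (rule blinfun_eqI) (simp add: rank_one_apply)

lemma norm_rank_one_apply_le:
  fixes L :: "'a::euclidean_space \<Rightarrow>\<^sub>L 'b::euclidean_space"
  shows "norm (rank_one d (L d)) \<le> norm L"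
proof (cases "d = 0")
  case False
  show ?thesis
  proof (rule norm_blinfun_bound)
    fix v
    have "norm (rank_one d (L d) v) = \<bar>d \<bullet> v\<bar> / (norm d)\<^sup>2 * norm (L d)"
      by (simp add: rank_one_apply)
    also have "\<dots> \<le> norm d * norm v / (norm d)\<^sup>2 * (norm L * norm d)"
      by (intro mult_mono divide_right_mono Cauchy_Schwarz_ineq2 norm_blinfun) auto
    also have "\<dots> = norm L * norm v" using False by (simp add: power2_eq_square)
    finally show "norm (rank_one d (L d) v) \<le> norm L * norm v" .
  qed simp
qed simp

definition secant_correction ::
  "('a::euclidean_space \<Rightarrow> 'b::euclidean_space) \<Rightarrow> ('a \<Rightarrow> 'a \<Rightarrow> 'a \<Rightarrow>\<^sub>L 'b) \<Rightarrow> 'a \<Rightarrow> 'a \<Rightarrow> 'a \<Rightarrow>\<^sub>L 'b" where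
  "secant_correction f A x y = A x y + rank_one (y - x) (f y - f x - A x y (y - x))"

lemma secant_correction_diagonal [simp]: "secant_correction f A x x = A x x"
  by (simp add: secant_correction_def)

lemma secant_correction_apply: "secant_correction f A x y (y - x) = f y - f x"
  by (cases "x = y") (simp_all add: secant_correction_def blinfun.add_left rank_one_apply_self)

lemma secant_correction_commute:
  assumes "A x y = A y x"
  shows "secant_correction f A x y = secant_correction f A y x"
proof -
  define w where "w = f y - f x - A x y (y - x)"
  have "f x - f y - A y x (x - y) = - w"
    using blinfun.minus_right[of "A x y" "y - x"] by (simp add: assms w_def)
  then have "secant_correction f A y x = A x y + rank_one (x - y) (- w)"
    by (simp add: secant_correction_def assms)
  also have "rank_one (x - y) (- w) = rank_one (y - x) w"
    using rank_one_minus[of "y - x" w] by simp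
  finally show ?thesis
    by (simp add: secant_correction_def w_def)
qed

text \<open>
  If \<open>S\<close> is a slope function of \<open>f\<close> at \<open>x\<close>, the defect \<open>f y - f x - A x y (y - x)\<close> equals
  \<open>(S y - A x y) (y - x)\<close>, so the correction has norm at most \<open>\<parallel>S y - A x y\<parallel>\<close>; this tends to \<open>0\<close>
  because \<open>A x\<close> and \<open>S\<close> have the same limit at \<open>x\<close>.
\<close>

lemma secant_correction_slope_function_at:
  assumes S: "slope_function_at U f x S"
    and A: "continuous (at x within U) (A x)" "A x x = S x"
  shows "slope_function_at U f x (secant_correction f A x)"
  unfolding slope_function_at_def
proof
  have "((\<lambda>y. S y - A x y) \<longlongrightarrow> S x - A x x) (at x within U)"
    using S A(1) unfolding slope_function_at_def continuous_within by (intro tendsto_diff) auto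
  then have lim: "((\<lambda>y. norm (S y - A x y)) \<longlongrightarrow> 0) (at x within U)"
    using A(2) by (simp add: tendsto_norm_zero)
  have "norm (secant_correction f A x y - A x y) \<le> norm (S y - A x y)" if "y \<in> U" for y
  proof -
    have "f y - f x - A x y (y - x) = (S y - A x y) (y - x)"
      using S that by (simp add: slope_function_at_def blinfun.diff_left)
    then show ?thesis by (simp add: secant_correction_def norm_rank_one_apply_le)
  qed
  then have "((\<lambda>y. secant_correction f A x y - A x y) \<longlongrightarrow> 0) (at x within U)"
    by (intro Lim_null_comparison[OF _ lim]) (simp add: eventually_at_filter)
  from tendsto_add[OF this A(1)[unfolded continuous_within]]
  show "continuous (at x within U) (secant_correction f A x)"
    by (simp add: continuous_within)
qed (simp add: secant_correction_apply)

section \<open>Symmetric slope functions\<close>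

lemma slope_function_at_imp_continuous:
  assumes "slope_function_at U f x S"
  shows "continuous (at x within U) f"
  using slope_function_at_imp_has_derivative[OF assms] by (rule has_derivative_continuous)

theorem exists_symmetric_slope_function:
  fixes f :: "'a::euclidean_space \<Rightarrow> 'b::euclidean_space"
  assumes U: "open U" and diff: "\<And>x. x \<in> U \<Longrightarrow> slope_differentiable_at U f x"
  obtains \<Phi> where "slope_function U f \<Phi>" "symmetric_on U \<Phi>"
proof -
  obtain S where S: "slope_function_at U f x (S x)" if "x \<in> U" for x
    using diff unfolding slope_differentiable_at_def by metis
  have f: "continuous_on U f"
    using slope_function_at_imp_continuous[OF S] by (simp add: continuous_on_eq_continuous_within)
  obtain A where A: "\<And>x y. A x y = A y x" "\<And>x. A x x = S x x" "\<And>x. x \<in> U \<Longrightarrow> isCont (A x) x"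
  proof (rule symmetric_extension_from_diagonal)
    show "\<forall>\<^sub>F k in sequentially. isCont (difference_matrix f k) x" if "x \<in> U" for x
      using U that f by (rule difference_matrix_eventually_isCont)
    show "(\<lambda>k. difference_matrix f k x) \<longlonglongrightarrow> S x x" if "x \<in> U" for x
      using U that S[OF that] by (rule difference_matrix_tendsto)
  qed blast
  show thesis
  proof
    show "slope_function U f (secant_correction f A)"
      unfolding slope_function_def
    proof
      fix x assume x: "x \<in> U"
      show "slope_function_at U f x (secant_correction f A x)"
        using S[OF x] continuous_at_imp_continuous_at_within[OF A(3)[OF x]] A(2)
        by (rule secant_correction_slope_function_at)
    qed
    show "symmetric_on U (secant_correction f A)"
      unfolding symmetric_on_def by (intro ballI secant_correction_commute A(1))
  qed
qed

lemma symmetric_slope_function_separately_continuous: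
  assumes \<Phi>: "slope_function U f \<Phi>" and sym: "symmetric_on U \<Phi>"
  shows "separately_continuous_on_diagonal U \<Phi>"
  unfolding separately_continuous_on_diagonal_def
proof (intro ballI conjI)
  fix x assume x: "x \<in> U"
  show *: "continuous (at x within U) (\<lambda>y. \<Phi> x y)"
    using \<Phi> x by (simp add: slope_function_def slope_function_at_def)
  show "continuous (at x within U) (\<lambda>y. \<Phi> y x)"
    by (rule continuous_transform_within[OF * zero_less_one x])
      (use sym x in \<open>simp add: symmetric_on_def\<close>)
qed

theorem mainTheorem5:
  fixes U :: "(real ^ 'n) set" and f :: "real ^ 'n \<Rightarrow> real ^ 'm"
  assumes "open U"
    and "\<forall>x\<in>U. slope_differentiable_at U f x"
  shows "(\<exists>\<Phi> :: real ^ 'n \<Rightarrow> real ^ 'n \<Rightarrow> (real ^ 'n) \<Rightarrow>\<^sub>L (real ^ 'm).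
            slope_function U f \<Phi> \<and> separately_continuous_on_diagonal U \<Phi>)
       \<and> (\<exists>\<Phi> :: real ^ 'n \<Rightarrow> real ^ 'n \<Rightarrow> (real ^ 'n) \<Rightarrow>\<^sub>L (real ^ 'm).
            slope_function U f \<Phi> \<and> separately_continuous_on_diagonal U \<Phi> \<and> symmetric_on U \<Phi>)"
proof -
  obtain \<Phi> where "slope_function U f \<Phi>" "symmetric_on U \<Phi>"
    using exists_symmetric_slope_function assms by blast
  with symmetric_slope_function_separately_continuous show ?thesis by blast
qed

end
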